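(* Let $V,U$ be real or complex vector spaces, each equipped with two norms $\|\cdot\|_1$ and $\|\cdot\|_\infty$, and let $A:V\to U$ and $B:U\to V$ be linear operators. Suppose that $\|A\|_{1\to\infty}\le 1$ and $\|B\|_{1\to\infty}\le 1$. Suppose too that, for some parameter $k>0$, $\|BAv\|_\infty\ge k\|v\|_\infty$ for all $v\in V$. Then for any $v\in V$, \[ \|v\|_1\,\|Av\|_1\ \ge\ k\,\|v\|_\infty\,\|Av\|_\infty . \]
   Context: For a linear map $A:V\to U$, $\|A\|_{1\to\infty}=\sup_{0\ne v\in V}\|Av\|_\infty/\|v\|_1$, where $\|\cdot\|_\infty$ is the given norm on $U$ and $\|\cdot\|_1$ is the given norm on $V$; similarly for $B:U\to V$. *)

theory Defs
  imports "HOL-Analysis.Analysis"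
begin

text \<open>
  The library attaches a norm to a type through the class \<^class>\<open>real_normed_vector\<close>, so a type
  carries only one. Here a norm is a function on the vector space, so that one space can have several.
  The scalar field has class \<^class>\<open>real_normed_field\<close>, of which both \<^typ>\<open>real\<close> and \<^typ>\<open>complex\<close>
  are instances.
\<close>

locale normed_by = vector_space scale
  for scale :: "'k::real_normed_field \<Rightarrow> 'a::ab_group_add \<Rightarrow> 'a" +
  fixes N :: "'a \<Rightarrow> real"
  assumes nonneg: "0 \<le> N x"
    and eq_zero_iff: "N x = 0 \<longleftrightarrow> x = 0"
    and triangle: "N (x + y) \<le> N x + N y"
    and homogeneous: "N (scale c x) = norm c * N x"

text \<open>
  The supremum is taken in \<^typ>\<open>ennreal\<close>: it is infinite for an unbounded operator, and it is 0
  if the domain is the zero space.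
\<close>

definition op_norm :: "('a::zero \<Rightarrow> real) \<Rightarrow> ('b \<Rightarrow> real) \<Rightarrow> ('a \<Rightarrow> 'b) \<Rightarrow> ennreal" where
  "op_norm N M T = (SUP v\<in>{v. v \<noteq> 0}. ennreal (M (T v) / N v))"

end

theory Submission
  imports Defs
begin

text \<open>
  The two operator bounds control the same vector \<open>A v\<close> from both sides. The bound on \<open>A\<close> gives
  \<open>\<parallel>A v\<parallel>\<^sub>\<infinity> \<le> \<parallel>v\<parallel>\<^sub>1\<close>. The bound on \<open>B\<close>, applied to the vector \<open>A v\<close>, gives
  \<open>\<parallel>B (A v)\<parallel>\<^sub>\<infinity> \<le> \<parallel>A v\<parallel>\<^sub>1\<close>, and hence \<open>k \<parallel>v\<parallel>\<^sub>\<infinity> \<le> \<parallel>A v\<parallel>\<^sub>1\<close>. All these quantities are nonnegative,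
  so the two inequalities can be multiplied.
\<close>

text \<open>
  For nonzero \<open>v\<close> the quotient at \<open>v\<close> is one of the terms of the supremum, and its denominator is
  positive. The zero vector is excluded from the supremum, and there both sides vanish because
  \<open>T\<close> is linear.
\<close>

lemma op_norm_le_imp_bound:
  fixes c :: real
  assumes N: "normed_by scaleX N" and M: "normed_by scaleY M"
    and T: "Vector_Spaces.linear scaleX scaleY T"
    and le: "op_norm N M T \<le> ennreal c" and "0 \<le> c"
  shows "M (T v) \<le> c * N v"
proof (cases "v = 0")
  case True
  have "T 0 = 0"
    using T by (rule module_hom.zero[OF Vector_Spaces.linear.axioms(3)])
  then show ?thesis
    using True normed_by.eq_zero_iff[OF N, of 0] normed_by.eq_zero_iff[OF M, of 0] by simp
next
  case False
  then have "0 < N v"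
    using normed_by.nonneg[OF N, of v] normed_by.eq_zero_iff[OF N, of v] by simp
  have "ennreal (M (T v) / N v) \<le> op_norm N M T"
    unfolding op_norm_def using False by (intro SUP_upper) simp
  also note le
  finally have "M (T v) / N v \<le> c"
    using \<open>0 \<le> c\<close> by simp
  then show ?thesis
    using \<open>0 < N v\<close> by (simp add: divide_le_eq)
qed

theorem theorem2p1:
  fixes scaleV :: "'k::real_normed_field \<Rightarrow> 'v::ab_group_add \<Rightarrow> 'v"
    and scaleU :: "'k \<Rightarrow> 'u::ab_group_add \<Rightarrow> 'u"
    and normV1 normVinf :: "'v \<Rightarrow> real"
    and normU1 normUinf :: "'u \<Rightarrow> real"
    and A :: "'v \<Rightarrow> 'u" and B :: "'u \<Rightarrow> 'v"
    and k :: real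
  assumes "normed_by scaleV normV1" and "normed_by scaleV normVinf"
    and "normed_by scaleU normU1" and "normed_by scaleU normUinf"
    and "Vector_Spaces.linear scaleV scaleU A" and "Vector_Spaces.linear scaleU scaleV B"
    and "op_norm normV1 normUinf A \<le> 1" and "op_norm normU1 normVinf B \<le> 1"
    and "k > 0"
    and "\<forall>v. normVinf (B (A v)) \<ge> k * normVinf v"
  shows "\<forall>v. normV1 v * normU1 (A v) \<ge> k * normVinf v * normUinf (A v)"
proof
  fix v
  have "normUinf (A v) \<le> normV1 v"
    using op_norm_le_imp_bound[OF assms(1,4,5), of 1 v] assms(7) by simp
  moreover have "normVinf (B (A v)) \<le> normU1 (A v)"
    using op_norm_le_imp_bound[OF assms(3,2,6), of 1 "A v"] assms(8) by simp
  then have "k * normVinf v \<le> normU1 (A v)"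
    using assms(10) by (meson order_trans)
  ultimately have "normUinf (A v) * (k * normVinf v) \<le> normV1 v * normU1 (A v)"
    using \<open>k > 0\<close>
    by (intro mult_mono) (simp_all add: normed_by.nonneg[OF assms(1)] normed_by.nonneg[OF assms(2)])
  then show "normV1 v * normU1 (A v) \<ge> k * normVinf v * normUinf (A v)"
    by (simp add: mult.commute)
qed

end
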